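(* Let $(X,d)$ be an ultrametric space whose value set $\Gamma$ is a countable narrow poset, and let $(X,\mathcal{B}_d)$ be its ultrametric ball space. Then: 1) the ball space $(X,\operatorname{ci}(\mathcal{B}_d))$ is chain intersection closed; 2) if $(X,\mathcal{B}_d)$ is spherically complete, then so is $(X,\operatorname{ci}(\mathcal{B}_d))$.
   Context: A poset is narrow if it contains no infinite set of pairwise incomparable elements. A ball space $(X,\mathcal{B})$ is a nonempty set $X$ with a nonempty collection $\mathcal{B}$ of nonempty subsets of $X$. A chain in $\mathcal{B}$ is a nonempty subset of $\mathcal{B}$ linearly ordered by inclusion. $(X,\mathcal{B})$ is spherically complete if every chain in $\mathcal{B}$ has nonempty intersection. $\operatorname{ci}(\mathcal{B})$ is the family of all nonempty sets $\bigcap\mathcal{C}$ with $\mathcal{C}\subseteq\mathcal{B}$ a chain. $(X,\mathcal{B})$ is chain intersection closed if $\operatorname{ci}(\mathcal{B})=\mathcal{B}$. An ultrametric on $X$ is a map $d:X\times X\to\Gamma$, $\Gamma$ a poset with least element $\bot$, such that for all $x,y,z\in X$, $\gamma\in\Gamma$: $d(x,y)=\bot$ iff $x=y$; if $d(x,y)\le\gamma$ and $d(y,z)\le\gamma$ then $d(x,z)\le\gamma$; $d(x,y)=d(y,x)$. For $x,y\in X$, $B(x,y)=\{z\in X: d(x,z)\le d(x,y)\}$ and $\mathcal{B}_d=\{B(x,y):x,y\in X\}$. *)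

theory Defs
  imports Main "HOL-Library.Countable_Set"
begin

definition narrow :: "'g::order set \<Rightarrow> bool" where
  "narrow \<Gamma> \<longleftrightarrow>
     \<not> (\<exists>A \<subseteq> \<Gamma>. infinite A \<and> (\<forall>a\<in>A. \<forall>b\<in>A. a \<noteq> b \<longrightarrow> \<not> a \<le> b \<and> \<not> b \<le> a))"

definition ball_space :: "'a set \<Rightarrow> 'a set set \<Rightarrow> bool" where
  "ball_space X \<B> \<longleftrightarrow> X \<noteq> {} \<and> \<B> \<noteq> {} \<and> (\<forall>B\<in>\<B>. B \<noteq> {} \<and> B \<subseteq> X)"

definition ball_chain :: "'a set set \<Rightarrow> 'a set set \<Rightarrow> bool" where
  "ball_chain \<B> \<C> \<longleftrightarrow> \<C> \<noteq> {} \<and> subset.chain \<B> \<C>"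

definition spherically_complete :: "'a set \<Rightarrow> 'a set set \<Rightarrow> bool" where
  "spherically_complete X \<B> \<longleftrightarrow>
     ball_space X \<B> \<and> (\<forall>\<C>. ball_chain \<B> \<C> \<longrightarrow> \<Inter>\<C> \<noteq> {})"

definition ci :: "'a set set \<Rightarrow> 'a set set" where
  "ci \<B> = {\<Inter>\<C> | \<C>. ball_chain \<B> \<C> \<and> \<Inter>\<C> \<noteq> {}}"

definition chain_intersection_closed :: "'a set \<Rightarrow> 'a set set \<Rightarrow> bool" where
  "chain_intersection_closed X \<B> \<longleftrightarrow> ball_space X \<B> \<and> ci \<B> = \<B>"

text \<open>The value poset is a subset \<open>\<Gamma>\<close> of a partially ordered type, with the induced order;
  only \<open>\<Gamma>\<close> itself, not the ambient type, is required to have a least element.\<close>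

locale ultrametric_space =
  fixes X :: "'a set" and \<Gamma> :: "'g::order set" and bt :: 'g
    and d :: "'a \<Rightarrow> 'a \<Rightarrow> 'g"
  assumes nonempty: "X \<noteq> {}"
    and bot_in: "bt \<in> \<Gamma>"
    and bot_least: "\<gamma> \<in> \<Gamma> \<Longrightarrow> bt \<le> \<gamma>"
    and dist_in: "\<lbrakk>x \<in> X; y \<in> X\<rbrakk> \<Longrightarrow> d x y \<in> \<Gamma>"
    and dist_eq_bot_iff: "\<lbrakk>x \<in> X; y \<in> X\<rbrakk> \<Longrightarrow> d x y = bt \<longleftrightarrow> x = y"
    and ultrametric_triangle:
      "\<lbrakk>x \<in> X; y \<in> X; z \<in> X; \<gamma> \<in> \<Gamma>; d x y \<le> \<gamma>; d y z \<le> \<gamma>\<rbrakk> \<Longrightarrow> d x z \<le> \<gamma>"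
    and dist_sym: "\<lbrakk>x \<in> X; y \<in> X\<rbrakk> \<Longrightarrow> d x y = d y x"

definition ultrametric_ball :: "'a set \<Rightarrow> ('a \<Rightarrow> 'a \<Rightarrow> 'g::order) \<Rightarrow> 'a \<Rightarrow> 'a \<Rightarrow> 'a set" where
  "ultrametric_ball X d x y = {z \<in> X. d x z \<le> d x y}"

definition ultrametric_balls :: "'a set \<Rightarrow> ('a \<Rightarrow> 'a \<Rightarrow> 'g::order) \<Rightarrow> 'a set set" where
  "ultrametric_balls X d = {ultrametric_ball X d x y | x y. x \<in> X \<and> y \<in> X}"

end

theory Submission imports Defs begin

text \<open>
  Let \<open>\<D>\<close> be a chain of intersections of chains of balls, and let \<open>U\<close> be the family of all balls
  in these chains. Any two members of \<open>U\<close> meet, so inclusion between them follows from comparing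
  radii; hence \<open>U\<close> is itself countable and narrow. As in the theorem of Erdos and Tarski, a narrow
  poset is a finite union of down-directed parts, and a countable down-directed part has a
  coinitial chain. By pigeonhole along the chains, one of these finitely many coinitial chains has
  an intersection contained in every member of \<open>\<D>\<close>, so it has the same intersection as \<open>\<D>\<close>.
  Both claims follow.
\<close>

section \<open>Narrow posets\<close>

text \<open>For elements of \<open>U\<close>, incompatibility implies incomparability, so narrowness
  also bounds pairwise incompatible families.\<close>

definition compatible :: "'g::order set \<Rightarrow> 'g \<Rightarrow> 'g \<Rightarrow> bool" where
  "compatible U x y \<longleftrightarrow> (\<exists>z\<in>U. z \<le> x \<and> z \<le> y)"

text \<open>A common lower bound of \<open>y\<close> and \<open>z\<close> is again below
  \<open>g\<close>, so the part of \<open>U\<close> below \<open>g\<close> is down-directed in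
  itself.\<close>

definition directed_below :: "'g::order set \<Rightarrow> 'g \<Rightarrow> bool" where
  "directed_below U g \<longleftrightarrow> (\<forall>y\<in>U. \<forall>z\<in>U. y \<le> g \<longrightarrow> z \<le> g \<longrightarrow> compatible U y z)"

lemma compatible_sym: "compatible U x y \<Longrightarrow> compatible U y x"
  by (auto simp: compatible_def)

lemma compatible_mono: "compatible U x y \<Longrightarrow> x \<le> x' \<Longrightarrow> y \<le> y' \<Longrightarrow> compatible U x' y'"
  unfolding compatible_def by (blast intro: order_trans)

lemma le_imp_compatible: "x \<in> U \<Longrightarrow> x \<le> y \<Longrightarrow> compatible U x y"
  by (auto simp: compatible_def)

text \<open>Reflecting the order makes \<open>f\<close> injective, by antisymmetry, and makes it
  carry antichains to antichains. Later \<open>f\<close> sends a ball to a radius.\<close>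

lemma narrow_reflect:
  fixes f :: "'h::order \<Rightarrow> 'g::order"
  assumes "narrow \<Gamma>" "f ` U \<subseteq> \<Gamma>"
    and refl: "\<And>x y. x \<in> U \<Longrightarrow> y \<in> U \<Longrightarrow> f x \<le> f y \<Longrightarrow> x \<le> y"
  shows "narrow U"
  unfolding narrow_def
proof clarify
  fix A assume A: "A \<subseteq> U" "infinite A"
    and anti: "\<forall>a\<in>A. \<forall>b\<in>A. a \<noteq> b \<longrightarrow> \<not> a \<le> b \<and> \<not> b \<le> a"
  have "inj_on f A"
    using A(1) refl by (intro inj_onI) (metis order_antisym order_refl subsetD)
  then have "infinite (f ` A)" using A(2) by (simp add: finite_image_iff)
  moreover have "f ` A \<subseteq> \<Gamma>" using A(1) assms(2) by blast
  moreover have "\<forall>u\<in>f ` A. \<forall>v\<in>f ` A. u \<noteq> v \<longrightarrow> \<not> u \<le> v \<and> \<not> v \<le> u"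
    using A(1) anti refl by (smt (verit, best) imageE subsetD)
  ultimately have "\<exists>B\<subseteq>\<Gamma>. infinite B \<and> (\<forall>u\<in>B. \<forall>v\<in>B. u \<noteq> v \<longrightarrow> \<not> u \<le> v \<and> \<not> v \<le> u)"
    by (intro exI[of _ "f ` A"] conjI)
  then show False using assms(1) unfolding narrow_def by (rule notE[rotated])
qed

lemma narrow_finite_incompatible:
  assumes "narrow U" "A \<subseteq> U" "pairwise (\<lambda>x y. \<not> compatible U x y) A"
  shows "finite A"
proof (rule ccontr)
  assume "infinite A"
  moreover have "\<forall>a\<in>A. \<forall>b\<in>A. a \<noteq> b \<longrightarrow> \<not> a \<le> b \<and> \<not> b \<le> a"
    using assms(2,3) unfolding pairwise_def
    by (metis compatible_sym le_imp_compatible subsetD)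
  ultimately show False using assms(1,2) unfolding narrow_def by blast
qed

text \<open>Otherwise every element of \<open>U\<close> below \<open>x\<close> has two incompatible
  elements under it. Splitting over and over, always setting one of the two aside, gives an infinite
  pairwise incompatible family.\<close>

lemma narrow_directed_below:
  assumes "narrow U" "x \<in> U"
  shows "\<exists>g\<in>U. g \<le> x \<and> directed_below U g"
proof (rule ccontr)
  assume no: "\<not> ?thesis"
  have split: "\<exists>y\<in>U. \<exists>z\<in>U. y \<le> w \<and> z \<le> w \<and> \<not> compatible U y z" if "w \<in> U" "w \<le> x" for w
    using no that unfolding directed_below_def by blast
  \<comment> \<open>The first component of a pair is set aside; the second is split next and so has
    to stay below \<open>x\<close>.\<close>
  define P where "P p \<longleftrightarrow> fst p \<in> U \<and> snd p \<in> U \<and> snd p \<le> x \<and> \<not> compatible U (fst p) (snd p)" for p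
  have "\<exists>s. \<forall>n. P (s n) \<and> fst (s (Suc n)) \<le> snd (s n) \<and> snd (s (Suc n)) \<le> snd (s n)"
  proof (rule dependent_nat_choice)
    show "\<exists>p. P p" using split[OF assms(2) order_refl] by (auto simp: P_def)
  next
    fix p and n :: nat assume "P p"
    then obtain y z where "y \<in> U" "z \<in> U" "y \<le> snd p" "z \<le> snd p" "\<not> compatible U y z"
      using split unfolding P_def by meson
    with \<open>P p\<close> show "\<exists>q. P q \<and> fst q \<le> snd p \<and> snd q \<le> snd p"
      by (intro exI[of _ "(y, z)"]) (auto simp: P_def)
  qed
  then obtain s where P: "\<And>n. P (s n)"
    and fst_le: "\<And>n. fst (s (Suc n)) \<le> snd (s n)" and snd_le: "\<And>n. snd (s (Suc n)) \<le> snd (s n)"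
    by blast
  define a where "a n = fst (s n)" for n
  have aU: "a n \<in> U" for n using P by (simp add: a_def P_def)
  have below: "a m \<le> snd (s n)" if "n < m" for m n
  proof -
    obtain k where k: "m = Suc k" "n \<le> k" using \<open>n < m\<close> by (cases m) auto
    have "snd (s k) \<le> snd (s n)" using lift_Suc_antimono_le[of "\<lambda>i. snd (s i)"] snd_le k(2) by blast
    then show ?thesis using fst_le[of k] k(1) by (simp add: a_def)
  qed
  \<comment> \<open>A common lower bound of \<open>a n\<close> and \<open>a m\<close> would also be
    one of \<open>a n\<close> and \<open>snd (s n)\<close>.\<close>
  have "\<not> compatible U (a n) (a m)" if "n < m" for m n
    using P[of n] below[OF that] compatible_mono unfolding P_def a_def by blast
  then have inc: "\<not> compatible U (a n) (a m)" if "n \<noteq> m" for m n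
    using that compatible_sym by (metis linorder_neqE_nat)
  have "inj a"
    using inc aU by (intro injI) (metis le_imp_compatible order_refl)
  then have "infinite (range a)" by (simp add: finite_image_iff)
  moreover have "finite (range a)"
    using inc aU by (intro narrow_finite_incompatible[OF assms(1)]) (auto simp: pairwise_def, metis)
  ultimately show False by simp
qed

text \<open>A maximal pairwise incompatible set of elements with directed lower part is finite by
  narrowness. As every element of \<open>U\<close> has such an element below it, maximality gives
  the covering property.\<close>

lemma narrow_finite_directed_cover:
  assumes "narrow U"
  obtains A where "finite A" "A \<subseteq> U" "\<And>a. a \<in> A \<Longrightarrow> directed_below U a"
    "\<And>y. y \<in> U \<Longrightarrow> \<exists>a\<in>A. compatible U y a"
proof -
  define F where
    "F = {A. A \<subseteq> {g \<in> U. directed_below U g} \<and> pairwise (\<lambda>x y. \<not> compatible U x y) A}"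
  have "\<exists>M\<in>F. \<forall>A\<in>F. M \<subseteq> A \<longrightarrow> A = M"
  proof (rule subset_Zorn')
    fix K assume K: "subset.chain F K"
    have "pairwise (\<lambda>x y. \<not> compatible U x y) (\<Union>K)"
      using K unfolding F_def by (intro pairwise_chain_Union) (auto simp: subset_chain_def chain_subset_def)
    then show "\<Union>K \<in> F" using K by (auto simp: F_def subset_chain_def)
  qed
  then obtain A where A: "A \<in> F" and max: "\<And>B. B \<in> F \<Longrightarrow> A \<subseteq> B \<Longrightarrow> B = A" by blast
  show thesis
  proof
    show "A \<subseteq> U" "\<And>a. a \<in> A \<Longrightarrow> directed_below U a" using A by (auto simp: F_def)
    then show "finite A" using A by (intro narrow_finite_incompatible[OF assms]) (auto simp: F_def)
    fix y assume "y \<in> U"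
    then obtain g where g: "g \<in> U" "g \<le> y" "directed_below U g"
      using narrow_directed_below[OF assms] by blast
    have "\<exists>a\<in>A. compatible U g a"
    proof (rule ccontr)
      assume no: "\<not> ?thesis"
      then have "insert g A \<in> F"
        using A g by (auto simp: F_def pairwise_insert dest: compatible_sym)
      then have "g \<in> A" using max by blast
      with no g(1) show False using le_imp_compatible by blast
    qed
    then show "\<exists>a\<in>A. compatible U y a" using compatible_mono g(2) by blast
  qed
qed

section \<open>Chains of sets\<close>

text \<open>If each \<open>a\<close> failed at some \<open>f a\<close>, a member of the chain below
  these finitely many sets would admit no \<open>a\<close>, since failure passes to smaller
  sets.\<close>

lemma chain_pigeonhole:
  assumes "subset.chain S C" "C \<noteq> {}" "finite A"
    and ex: "\<And>b. b \<in> C \<Longrightarrow> \<exists>a\<in>A. P a b"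
    and mono: "\<And>a b b'. a \<in> A \<Longrightarrow> P a b \<Longrightarrow> b \<subseteq> b' \<Longrightarrow> P a b'"
  shows "\<exists>a\<in>A. \<forall>b\<in>C. P a b"
proof (rule ccontr)
  assume "\<not> ?thesis"
  then obtain f where f: "\<And>a. a \<in> A \<Longrightarrow> f a \<in> C \<and> \<not> P a (f a)" by metis
  have "\<exists>b\<in>C. \<forall>a\<in>A'. b \<subseteq> f a" if "finite A'" "A' \<subseteq> A" for A'
    using that
  proof (induction A')
    case empty
    then show ?case using assms(2) by blast
  next
    case (insert a A')
    then obtain b where "b \<in> C" "\<forall>a\<in>A'. b \<subseteq> f a" by auto
    moreover have "f a \<in> C" using f insert by blast
    moreover have "b \<subseteq> f a \<or> f a \<subseteq> b"
      using assms(1) calculation unfolding subset_chain_def by blast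
    ultimately show ?case by (metis insert_iff order_refl order_trans)
  qed
  then obtain b where "b \<in> C" "\<forall>a\<in>A. b \<subseteq> f a" using assms(3) by blast
  then show False using ex f mono by metis
qed

lemma countable_directed_coinitial_chain:
  assumes "countable V" "V \<noteq> {}"
    and dir: "\<And>x y. x \<in> V \<Longrightarrow> y \<in> V \<Longrightarrow> \<exists>z\<in>V. z \<subseteq> x \<and> z \<subseteq> y"
  shows "\<exists>C. C \<noteq> {} \<and> subset.chain V C \<and> (\<forall>b\<in>V. \<exists>c\<in>C. c \<subseteq> b)"
proof -
  \<comment> \<open>\<open>from_nat_into V\<close> runs through all of \<open>V\<close>, with
    repetitions if \<open>V\<close> is finite. The start \<open>s 0\<close> is arbitrary, so the
    descent below the \<open>n\<close>-th element comes at \<open>Suc n\<close>.\<close>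
  have "\<exists>s. \<forall>n::nat. s n \<in> V \<and> s (Suc n) \<subseteq> s n \<and> s (Suc n) \<subseteq> from_nat_into V n"
  proof (rule dependent_nat_choice)
    show "\<exists>x. x \<in> V" using assms(2) by blast
    show "\<exists>y. y \<in> V \<and> y \<subseteq> x \<and> y \<subseteq> from_nat_into V n" if "x \<in> V" for x n
      using dir[OF that from_nat_into[OF assms(2)]] by blast
  qed
  then obtain s where s: "\<And>n. s n \<in> V" "\<And>n. s (Suc n) \<subseteq> s n"
    "\<And>n. s (Suc n) \<subseteq> from_nat_into V n" by blast
  have "s m \<subseteq> s n" if "n \<le> m" for m n
    using lift_Suc_antimono_le[of s] s(2) that by blast
  then have "subset.chain V (range s)"
    using s(1) unfolding subset_chain_def by (auto; metis nat_le_linear subsetD)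
  moreover have "\<exists>c\<in>range s. c \<subseteq> b" if "b \<in> V" for b
    using s(3) from_nat_into_surj[OF assms(1) that] by blast
  ultimately show ?thesis by blast
qed

text \<open>Pigeonhole is used twice on the finite cover \<open>A\<close>: along each chain
  \<open>C\<close>, then along \<open>\<D>\<close>. The hypothesis \<open>lower\<close> gives the
  reverse inclusion.\<close>

lemma narrow_chain_of_intersections:
  assumes "countable U" "narrow U" "\<D> \<noteq> {}" "subset.chain S \<D>"
    and chains: "\<And>D. D \<in> \<D> \<Longrightarrow> \<exists>C. C \<noteq> {} \<and> subset.chain U C \<and> \<Inter>C = D"
    and lower: "\<And>b. b \<in> U \<Longrightarrow> \<Inter>\<D> \<subseteq> b"
  shows "\<exists>C. C \<noteq> {} \<and> subset.chain U C \<and> \<Inter>C = \<Inter>\<D>"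
proof -
  obtain A where A: "finite A" "A \<subseteq> U" "\<And>a. a \<in> A \<Longrightarrow> directed_below U a"
    and cover: "\<And>y. y \<in> U \<Longrightarrow> \<exists>a\<in>A. compatible U y a"
    using narrow_finite_directed_cover[OF assms(2)] by blast
  have "\<exists>C. C \<noteq> {} \<and> subset.chain {b \<in> U. b \<subseteq> a} C \<and> (\<forall>b\<in>{b \<in> U. b \<subseteq> a}. \<exists>c\<in>C. c \<subseteq> b)"
    if "a \<in> A" for a
  proof (rule countable_directed_coinitial_chain)
    show "countable {b \<in> U. b \<subseteq> a}" using assms(1) by simp
    show "{b \<in> U. b \<subseteq> a} \<noteq> {}" using that A(2) by blast
    show "\<exists>z\<in>{b \<in> U. b \<subseteq> a}. z \<subseteq> x \<and> z \<subseteq> y"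
      if xy: "x \<in> {b \<in> U. b \<subseteq> a}" "y \<in> {b \<in> U. b \<subseteq> a}" for x y
    proof -
      have "x \<in> U" "x \<subseteq> a" "y \<in> U" "y \<subseteq> a" using xy by simp_all
      then have "compatible U x y" using A(3)[OF \<open>a \<in> A\<close>] by (simp add: directed_below_def)
      then obtain z where "z \<in> U" "z \<subseteq> x" "z \<subseteq> y" unfolding compatible_def by (elim bexE conjE)
      moreover from this \<open>x \<subseteq> a\<close> have "z \<subseteq> a" by (simp add: subset_trans)
      ultimately show ?thesis by simp (metis)
    qed
  qed
  from bchoice[OF ballI, OF this]
  obtain c where c: "\<forall>a\<in>A. c a \<noteq> {} \<and> subset.chain {b \<in> U. b \<subseteq> a} (c a) \<and>
      (\<forall>b\<in>{b \<in> U. b \<subseteq> a}. \<exists>x\<in>c a. x \<subseteq> b)"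
    by (rule exE)
  have "\<exists>a\<in>A. \<Inter>(c a) \<subseteq> D" if "D \<in> \<D>" for D
  proof -
    obtain C where C: "C \<noteq> {}" "subset.chain U C" "\<Inter>C = D"
      using chains \<open>D \<in> \<D>\<close> by blast
    \<comment> \<open>Compatibility with a fixed \<open>a\<close> passes to larger sets, as the
      pigeonhole argument requires.\<close>
    have "\<exists>a\<in>A. \<forall>b\<in>C. compatible U b a"
    proof (rule chain_pigeonhole[OF C(2,1) A(1)])
      show "\<exists>a\<in>A. compatible U b a" if "b \<in> C" for b
        using that C(2) cover by (auto simp: subset_chain_def)
    qed (use compatible_mono in blast)
    then obtain a where a: "a \<in> A" "\<And>b. b \<in> C \<Longrightarrow> compatible U b a" by blast
    \<comment> \<open>A common lower bound \<open>z\<close> of \<open>b\<close> and \<open>a\<close>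
      lies in the cone below \<open>a\<close>, where \<open>c a\<close> is coinitial.\<close>
    have "\<Inter>(c a) \<subseteq> b" if "b \<in> C" for b
    proof -
      obtain z where "z \<in> U" "z \<subseteq> b" "z \<subseteq> a"
        using a(2)[OF \<open>b \<in> C\<close>] unfolding compatible_def by blast
      then obtain x where "x \<in> c a" "x \<subseteq> z" using bspec[OF c a(1)] by blast
      then show ?thesis using \<open>z \<subseteq> b\<close> by blast
    qed
    then show ?thesis using a(1) C(3) by blast
  qed
  \<comment> \<open>Containing \<open>\<Inter>(c a)\<close> is inherited by supersets, so one
    \<open>a\<close> serves the whole chain \<open>\<D>\<close>.\<close>
  then have "\<exists>a\<in>A. \<forall>D\<in>\<D>. \<Inter>(c a) \<subseteq> D"
    using chain_pigeonhole[OF assms(4,3) A(1), of "\<lambda>a D. \<Inter>(c a) \<subseteq> D"] by blast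
  then obtain a where a: "a \<in> A" "\<Inter>(c a) \<subseteq> \<Inter>\<D>" by blast
  have chain: "subset.chain U (c a)" using bspec[OF c a(1)] by (auto simp: subset_chain_def)
  then have "\<Inter>\<D> \<subseteq> \<Inter>(c a)" using lower by (auto simp: subset_chain_def)
  then show ?thesis using a bspec[OF c a(1)] chain by blast
qed

section \<open>Ultrametric balls\<close>

context ultrametric_space
begin

text \<open>Through a common point \<open>p\<close> the centre \<open>x\<close> is within
  \<open>d x' y'\<close> of \<open>x'\<close>; one more triangle step carries this bound to every
  \<open>z\<close>.\<close>

lemma ultrametric_ball_mono:
  assumes "x \<in> X" "y \<in> X" "x' \<in> X" "y' \<in> X" and le: "d x y \<le> d x' y'"
    and meet: "ultrametric_ball X d x y \<inter> ultrametric_ball X d x' y' \<noteq> {}"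
  shows "ultrametric_ball X d x y \<subseteq> ultrametric_ball X d x' y'"
proof
  fix z assume "z \<in> ultrametric_ball X d x y"
  then have z: "z \<in> X" "d x z \<le> d x' y'" using le by (auto simp: ultrametric_ball_def)
  obtain p where p: "p \<in> X" "d x p \<le> d x' y'" "d x' p \<le> d x' y'"
    using meet le by (force simp: ultrametric_ball_def intro: order_trans)
  have G: "d x' y' \<in> \<Gamma>" using assms dist_in by blast
  have "d p x \<le> d x' y'" using p assms(1) dist_sym by simp
  then have "d x' x \<le> d x' y'" using ultrametric_triangle[OF assms(3) p(1) assms(1) G p(3)] by simp
  then have "d x' z \<le> d x' y'" using ultrametric_triangle[OF assms(3,1) z(1) G] z(2) by simp
  then show "z \<in> ultrametric_ball X d x' y'" using z by (simp add: ultrametric_ball_def)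
qed

lemma intersecting_balls_countable_narrow:
  assumes "countable \<Gamma>" "narrow \<Gamma>" "U \<subseteq> ultrametric_balls X d"
    and meet: "\<And>b b'. b \<in> U \<Longrightarrow> b' \<in> U \<Longrightarrow> b \<inter> b' \<noteq> {}"
  shows "countable U" "narrow U"
proof -
  have "\<forall>b\<in>U. \<exists>x y. x \<in> X \<and> y \<in> X \<and> b = ultrametric_ball X d x y"
    using assms(3) unfolding ultrametric_balls_def by blast
  then obtain f g where fg:
    "\<And>b. b \<in> U \<Longrightarrow> f b \<in> X \<and> g b \<in> X \<and> b = ultrametric_ball X d (f b) (g b)" by metis
  \<comment> \<open>A ball may have several centres and radii; \<open>r\<close> is the radius of a
    chosen representation. On pairwise intersecting balls it reflects inclusion, so countability and
    narrowness pull back from \<Gamma>.\<close>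
  define r where "r b = d (f b) (g b)" for b
  have sub: "r ` U \<subseteq> \<Gamma>" using fg dist_in by (auto simp: r_def)
  have refl: "b \<subseteq> b'" if "b \<in> U" "b' \<in> U" "r b \<le> r b'" for b b'
    using ultrametric_ball_mono[of "f b" "g b" "f b'" "g b'"] fg[OF that(1)] fg[OF that(2)]
      meet[OF that(1,2)] that(3) unfolding r_def by metis
  show "narrow U" using narrow_reflect[OF assms(2) sub] refl by blast
  have "inj_on r U" using refl by (intro inj_onI) (metis order_refl subset_antisym)
  then show "countable U" using countable_subset[OF sub assms(1)] countable_image_inj_on by blast
qed

lemma ball_space_ultrametric_balls: "ball_space X (ultrametric_balls X d)"
proof -
  have "y \<in> ultrametric_ball X d x y" if "y \<in> X" for x y
    using that by (simp add: ultrametric_ball_def)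
  then show ?thesis using nonempty
    by (auto simp: ball_space_def ultrametric_balls_def) (auto simp: ultrametric_ball_def)
qed

text \<open>Both claims of the theorem rest on this. \<open>\<Inter>\<D>\<close> may be empty here,
  so that spherical completeness can be transferred.\<close>

lemma ci_chain_intersection:
  assumes "countable \<Gamma>" "narrow \<Gamma>" and D: "ball_chain (ci (ultrametric_balls X d)) \<D>"
  shows "\<exists>\<C>. ball_chain (ultrametric_balls X d) \<C> \<and> \<Inter>\<C> = \<Inter>\<D>"
proof -
  let ?B = "ultrametric_balls X d"
  have ch: "\<D> \<noteq> {}" "subset.chain (ci ?B) \<D>" using D by (auto simp: ball_chain_def)
  have "\<forall>D\<in>\<D>. \<exists>C. ball_chain ?B C \<and> D = \<Inter>C \<and> D \<noteq> {}"
    using ch(2) unfolding subset_chain_def ci_def by blast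
  then obtain K where K: "\<And>D. D \<in> \<D> \<Longrightarrow> ball_chain ?B (K D) \<and> D = \<Inter>(K D) \<and> D \<noteq> {}" by metis
  define U where "U = \<Union>(K ` \<D>)"
  have UB: "U \<subseteq> ?B" using K unfolding U_def ball_chain_def subset_chain_def by blast
  have above: "\<exists>D\<in>\<D>. D \<subseteq> b" if "b \<in> U" for b using that K unfolding U_def by blast
  \<comment> \<open>Each ball of \<open>U\<close> contains a member of \<open>\<D>\<close>; the
    smaller of two such members is nonempty and lies in both balls.\<close>
  have "b \<inter> b' \<noteq> {}" if "b \<in> U" "b' \<in> U" for b b'
  proof -
    obtain D D' where DD: "D \<in> \<D>" "D' \<in> \<D>" "D \<subseteq> b" "D' \<subseteq> b'" using above \<open>b \<in> U\<close> \<open>b' \<in> U\<close> by metis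
    then have "D \<subseteq> D' \<or> D' \<subseteq> D" using ch(2) unfolding subset_chain_def by blast
    then show ?thesis using DD K[of D] K[of D'] by blast
  qed
  then have "countable U" "narrow U"
    using intersecting_balls_countable_narrow[OF assms(1,2) UB] by blast+
  then have "\<exists>C. C \<noteq> {} \<and> subset.chain U C \<and> \<Inter>C = \<Inter>\<D>"
  proof (rule narrow_chain_of_intersections[OF _ _ ch])
    show "\<exists>C. C \<noteq> {} \<and> subset.chain U C \<and> \<Inter>C = D" if "D \<in> \<D>" for D
      using K[OF that] that
      by (intro exI[of _ "K D"]) (auto simp: ball_chain_def subset_chain_def U_def)
    show "\<Inter>\<D> \<subseteq> b" if "b \<in> U" for b using above[OF that] by blast
  qed
  then show ?thesis using UB unfolding ball_chain_def subset_chain_def by (meson order_trans)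
qed

end

section \<open>Chain intersections in general ball spaces, and the conclusion\<close>

lemma subset_ci: "ball_space X \<B> \<Longrightarrow> \<B> \<subseteq> ci \<B>"
proof
  fix B assume "ball_space X \<B>" "B \<in> \<B>"
  then have "ball_chain \<B> {B}" "\<Inter>{B} \<noteq> {}"
    by (auto simp: ball_space_def ball_chain_def subset_chain_def)
  then show "B \<in> ci \<B>" unfolding ci_def by (metis (mono_tags, lifting) cInf_singleton mem_Collect_eq)
qed

lemma ball_space_ci:
  assumes "ball_space X \<B>"
  shows "ball_space X (ci \<B>)"
proof -
  have "D \<noteq> {} \<and> D \<subseteq> X" if "D \<in> ci \<B>" for D
  proof -
    obtain C where C: "C \<noteq> {}" "C \<subseteq> \<B>" "D = \<Inter>C" "D \<noteq> {}"
      using \<open>D \<in> ci \<B>\<close> unfolding ci_def ball_chain_def subset_chain_def by blast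
    have "B \<subseteq> X" if "B \<in> C" for B using that C(2) assms by (auto simp: ball_space_def)
    then have "\<Inter>C \<subseteq> X" using C(1) by (intro Inter_subset)
    then show ?thesis using C(3,4) by simp
  qed
  moreover have "ci \<B> \<noteq> {}" "X \<noteq> {}" using subset_ci[OF assms] assms by (auto simp: ball_space_def)
  ultimately show ?thesis unfolding ball_space_def by simp
qed

theorem theorem1p2:
  fixes X :: "'a set" and \<Gamma> :: "'g::order set" and bt :: 'g
    and d :: "'a \<Rightarrow> 'a \<Rightarrow> 'g"
  assumes "ultrametric_space X \<Gamma> bt d"
    and "countable \<Gamma>"
    and "narrow \<Gamma>"
  shows "chain_intersection_closed X (ci (ultrametric_balls X d)) \<and>
    (spherically_complete X (ultrametric_balls X d)
       \<longrightarrow> spherically_complete X (ci (ultrametric_balls X d)))"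
proof -
  interpret ultrametric_space X \<Gamma> bt d by fact
  let ?B = "ultrametric_balls X d"
  have space: "ball_space X (ci ?B)" using ball_space_ci[OF ball_space_ultrametric_balls] .
  note flatten = ci_chain_intersection[OF assms(2,3)]
  have "ci (ci ?B) \<subseteq> ci ?B"
  proof
    fix E assume "E \<in> ci (ci ?B)"
    then obtain \<D> where "ball_chain (ci ?B) \<D>" "E = \<Inter>\<D>" "E \<noteq> {}" by (auto simp: ci_def)
    with flatten show "E \<in> ci ?B" unfolding ci_def[of ?B] by (metis (mono_tags, lifting) mem_Collect_eq)
  qed
  then have "chain_intersection_closed X (ci ?B)"
    using space subset_ci[OF space] by (auto simp: chain_intersection_closed_def)
  \<comment> \<open>\<open>flatten\<close> turns a chain in \<open>ci ?B\<close> into a chain of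
    balls with the same intersection, which is nonempty by hypothesis.\<close>
  moreover have "spherically_complete X (ci ?B)" if "spherically_complete X ?B"
    using that space flatten unfolding spherically_complete_def by metis
  ultimately show ?thesis by blast
qed

end
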